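(* For every $n\ge0$, the map $F_R$ is a bijection from $\mathrm{PW}_n$ onto the set of red-packed forests of weight $n$, and $T_R$ is a bijection from the set of irreducible packed words of length $n$ onto the set of red-packed trees of weight $n$. Their inverses are the maps $F_R^*$, $T_R^*$ defined recursively by $F_R^*([])=\varepsilon$, $F_R^*([t_1,\dots,t_k])=T_R^*(t_1)\odot\cdots\odot T_R^*(t_k)$, and $T_R^*(\mathrm{Node}(I,f_\ell,f_r))=F_R^*(f_\ell)\triangleleft_R\phi_I(F_R^*(f_r))$.
   Context: Words over positive integers; $|w|$ length, $\max(w)$ largest letter ($\max(\varepsilon)=0$), $w^{[k]}$ adds $k$ to all letters. Packed: every integer $1..\max(w)$ occurs; $\mathrm{PW}_n$ packed words of length $n$. Left-shifted concatenation $u\odot v=u^{[\max(v)]}\cdot v$ (associative). A global descent of $w\in\mathrm{PW}_n$ is $c$, $1\le c\le n-1$, with every letter among $w_1..w_c$ strictly greater than every letter among $w_{c+1}..w_n$; $w$ is irreducible if nonempty without global descent. Every packed $w$ decomposes uniquely as $w=w_1\odot\cdots\odot w_k$ with all $w_j$ irreducible ($k=0$ iff $w=\varepsilon$). For $w\in\mathrm{PW}_n$, $p\ge1$, $I=\{i_1<\dots<i_p\}\subseteq\{1,\dots,n+p\}$: $\phi_I(w)$ is the word of length $n+p$ with letter $\max(w)+1$ at positions in $I$ and the letters of $w$ in order elsewhere; each nonempty packed $v$ is uniquely $\phi_I(v')$. For packed $u$ and nonempty packed $v=\phi_I(v')$, $u\triangleleft_R v=\phi_{I+|u|}(u\odot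 v')$ with $I+|u|=\{i+|u|:i\in I\}$. The red-factorization of an irreducible $w$ is the (unique) pair $(u,v)$ of packed words, $v\ne\varepsilon$, with $w=u\triangleleft_R v$ and $|u|$ maximal. Biplane trees: $\mathrm{Node}(x,f_\ell,f_r)$ with root label $x$ and ordered possibly empty lists $f_\ell$ (left forest), $f_r$ (right forest) of trees; forests are ordered lists of trees. Red-packed trees are labeled by nonempty finite sets $I=\{i_1<\dots<i_p\}$ of positive integers; weight $\omega=|I|$ + weights of all children trees (forest weight = sum). $\mathrm{Node}(I,[\ell_1..\ell_g],[r_1..r_d])$ is red-packed if all children are red-packed and either ($d=0$, $I=\{1..p\}$) or ($d\ge1$, $1\le i_1\le\omega(r_1)$, $1\le p+\sum_j\omega(r_j)+1-i_p\le\omega(r_d)$); a red-packed forest is a list of red-packed trees. $F_R$, $T_R$ are defined by mutual recursion: $F_R(\varepsilon)=[]$; for packed $w=w_1\odot\cdots\odot w_k$ (irreducible decomposition), $F_R(w)=[T_R(w_1),\dots,T_R(w_k)]$; for irreducible $w$ with red-factorization $(u,\phi_I(v'))$, $T_R(w)=\mathrm{Node}(I,F_R(u),F_R(v'))$. *)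

theory Defs
  imports Main
begin

type_synonym word = "nat list"

definition wmax :: "word \<Rightarrow> nat" where
  "wmax w = Max (insert 0 (set w))"

definition shift :: "nat \<Rightarrow> word \<Rightarrow> word" where
  "shift k w = map (\<lambda>x. x + k) w"

definition packed :: "word \<Rightarrow> bool" where
  "packed w \<longleftrightarrow> set w = {1..wmax w}"

definition PW :: "nat \<Rightarrow> word set" where
  "PW n = {w. packed w \<and> length w = n}"

definition odot :: "word \<Rightarrow> word \<Rightarrow> word" (infixr "\<odot>" 65) where
  "u \<odot> v = shift (wmax v) u @ v"

definition odot_list :: "word list \<Rightarrow> word" where
  "odot_list ws = foldr (\<odot>) ws []"

definition global_descent :: "word \<Rightarrow> nat \<Rightarrow> bool" where
  "global_descent w c \<longleftrightarrow>
     1 \<le> c \<and> c < length w \<and> (\<forall>x\<in>set (take c w). \<forall>y\<in>set (drop c w). x > y)"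

definition irreducible_word :: "word \<Rightarrow> bool" where
  "irreducible_word w \<longleftrightarrow> packed w \<and> w \<noteq> [] \<and> \<not> (\<exists>c. global_descent w c)"

definition irreducible_decomp :: "word \<Rightarrow> word list" where
  "irreducible_decomp w = (THE ws. (\<forall>x\<in>set ws. irreducible_word x) \<and> odot_list ws = w)"

text \<open>Positions are counted from 1. A position \<open>i \<notin> I\<close> receives the letter of \<open>w\<close> whose
  (0-based) index is the number of positions before \<open>i\<close> outside \<open>I\<close>.\<close>

definition phi :: "nat set \<Rightarrow> word \<Rightarrow> word" where
  "phi I w = map (\<lambda>i. if i \<in> I then wmax w + 1 else w ! card ({1..<i} - I))
                 [1..<length w + card I + 1]"

definition is_phi_decomp :: "word \<Rightarrow> nat set \<Rightarrow> word \<Rightarrow> bool" where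
  "is_phi_decomp v I v' \<longleftrightarrow>
     packed v' \<and> I \<noteq> {} \<and> I \<subseteq> {1..length v' + card I} \<and> v = phi I v'"

definition phi_decomp :: "word \<Rightarrow> nat set \<times> word" where
  "phi_decomp v = (THE (I, v'). is_phi_decomp v I v')"

definition tri_R :: "word \<Rightarrow> word \<Rightarrow> word" (infix "\<triangleleft>\<^sub>R" 65) where
  "u \<triangleleft>\<^sub>R v = (case phi_decomp v of (I, v') \<Rightarrow> phi ((\<lambda>i. i + length u) ` I) (u \<odot> v'))"

definition is_tri_R_fact :: "word \<Rightarrow> word \<Rightarrow> word \<Rightarrow> bool" where
  "is_tri_R_fact w u v \<longleftrightarrow> packed u \<and> packed v \<and> v \<noteq> [] \<and> w = u \<triangleleft>\<^sub>R v"

definition is_red_fact :: "word \<Rightarrow> word \<Rightarrow> word \<Rightarrow> bool" where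
  "is_red_fact w u v \<longleftrightarrow> is_tri_R_fact w u v \<and>
     (\<forall>u' v'. is_tri_R_fact w u' v' \<longrightarrow> length u' \<le> length u)"

definition red_fact :: "word \<Rightarrow> word \<times> word" where
  "red_fact w = (THE (u, v). is_red_fact w u v)"

datatype 'a biplane_tree =
  Node (root_label: 'a) (left_forest: "'a biplane_tree list") (right_forest: "'a biplane_tree list")

type_synonym 'a biplane_forest = "'a biplane_tree list"

fun weight :: "nat set biplane_tree \<Rightarrow> nat" where
  "weight (Node I ls rs) = card I + sum_list (map weight ls) + sum_list (map weight rs)"

definition forest_weight :: "nat set biplane_forest \<Rightarrow> nat" where
  "forest_weight f = sum_list (map weight f)"

fun red_packed_tree :: "nat set biplane_tree \<Rightarrow> bool" where
  "red_packed_tree (Node I ls rs) \<longleftrightarrow>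
     finite I \<and> I \<noteq> {} \<and> (\<forall>i\<in>I. i \<ge> 1) \<and>
     (\<forall>t\<in>set ls. red_packed_tree t) \<and> (\<forall>t\<in>set rs. red_packed_tree t) \<and>
     (rs = [] \<and> I = {1..card I} \<or>
      rs \<noteq> [] \<and> 1 \<le> Min I \<and> Min I \<le> weight (hd rs) \<and>
      1 \<le> int (card I) + int (forest_weight rs) + 1 - int (Max I) \<and>
      int (card I) + int (forest_weight rs) + 1 - int (Max I) \<le> int (weight (last rs)))"

definition red_packed_forest :: "nat set biplane_forest \<Rightarrow> bool" where
  "red_packed_forest f \<longleftrightarrow> (\<forall>t\<in>set f. red_packed_tree t)"

function (sequential)
  F_R_star :: "nat set biplane_forest \<Rightarrow> word" and
  T_R_star :: "nat set biplane_tree \<Rightarrow> word" where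
  "F_R_star ts = odot_list (map T_R_star ts)"
| "T_R_star (Node I fl fr) = F_R_star fl \<triangleleft>\<^sub>R phi I (F_R_star fr)"
  by pat_completeness auto
termination
proof (relation "measure (case_sum (size_list size) size)", goal_cases)
  case 1 show ?case by simp
next
  case (2 ts t) 
  then show ?case by (induction ts) auto
qed auto

text \<open>The facts below show that the objects picked by the definite descriptions above exist and
  are unique; the termination of the recursion for \<open>F_R\<close> and \<open>T_R\<close> depends on them.\<close>

lemma wmax_Nil [simp]: "wmax [] = 0"
  by (simp add: wmax_def)

lemma wmax_ge: "x \<in> set w \<Longrightarrow> x \<le> wmax w"
  by (simp add: wmax_def)

lemma wmax_in: "w \<noteq> [] \<Longrightarrow> wmax w \<in> set w"
proof -
  assume "w \<noteq> []"
  then obtain x where x: "x \<in> set w" by (cases w) auto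
  have "wmax w \<in> insert 0 (set w)" unfolding wmax_def by (rule Max_in) auto
  then show ?thesis using x wmax_ge[OF x] by auto
qed

lemma wmax_eqI: "(\<And>x. x \<in> set w \<Longrightarrow> x \<le> m) \<Longrightarrow> m \<in> insert 0 (set w) \<Longrightarrow> wmax w = m"
  unfolding wmax_def by (rule Max_eqI) auto

lemma packed_Nil [simp]: "packed []"
  by (simp add: packed_def)

lemma packedI: "set w = {1..m} \<Longrightarrow> packed w \<and> wmax w = m"
proof -
  assume a: "set w = {1..m}"
  have "wmax w = m" by (rule wmax_eqI) (auto simp: a)
  then show ?thesis using a by (simp add: packed_def)
qed

lemma shift_0 [simp]: "shift 0 w = w"
  by (simp add: shift_def)

lemma length_shift [simp]: "length (shift k w) = length w"
  by (simp add: shift_def)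

lemma set_shift: "set (shift k w) = (\<lambda>x. x + k) ` set w"
  by (simp add: shift_def)

lemma shift_shift: "shift j (shift k w) = shift (k + j) w"
  by (simp add: shift_def add.assoc)

lemma shift_inj: "shift k u = shift k v \<Longrightarrow> u = v"
  by (metis (no_types, lifting) add_right_cancel injI list.inj_map_strong shift_def)

lemma odot_Nil [simp]: "[] \<odot> v = v" "u \<odot> [] = u"
  by (simp_all add: odot_def shift_def)

lemma length_odot [simp]: "length (u \<odot> v) = length u + length v"
  by (simp add: odot_def)

lemma wmax_odot: "wmax (u \<odot> v) = wmax u + wmax v"
proof (rule wmax_eqI)
  show "x \<le> wmax u + wmax v" if "x \<in> set (u \<odot> v)" for x
    using that wmax_ge[of _ u] wmax_ge[of _ v] by (fastforce simp: odot_def set_shift)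
  show "wmax u + wmax v \<in> insert 0 (set (u \<odot> v))"
    using wmax_in[of u] wmax_in[of v] by (cases "u = []"; cases "v = []") (auto simp: odot_def set_shift)
qed

lemma odot_assoc: "(u \<odot> v) \<odot> w = u \<odot> (v \<odot> w)"
proof -
  have "shift (wmax w) (u \<odot> v) = shift (wmax v + wmax w) u @ shift (wmax w) v"
    by (simp add: odot_def shift_def add.assoc)
  then show ?thesis by (simp add: odot_def[of "u \<odot> v"] odot_def[of u "v \<odot> w"] wmax_odot)
      (simp add: odot_def)
qed

lemma packed_odot: "packed u \<Longrightarrow> packed v \<Longrightarrow> packed (u \<odot> v)"
proof -
  assume a: "packed u" "packed v"
  have "(\<lambda>x. x + wmax v) ` {1..wmax u} = {1 + wmax v..wmax u + wmax v}"
    by (rule image_add_atLeastAtMost')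
  then have "set (u \<odot> v) = {1..wmax u + wmax v}"
    using a by (auto simp: packed_def odot_def set_shift)
  then show ?thesis using packedI by blast
qed

lemma odot_eq_length:
  assumes "u \<odot> v = u' \<odot> v'" "length u = length u'"
  shows "u = u' \<and> v = v'"
proof -
  have "v = v'" "shift (wmax v) u = shift (wmax v') u'"
    using assms by (auto simp: odot_def)
  then show ?thesis using shift_inj by blast
qed

lemma odot_list_Nil [simp]: "odot_list [] = []"
  by (simp add: odot_list_def)

lemma odot_list_Cons [simp]: "odot_list (x # xs) = x \<odot> odot_list xs"
  by (simp add: odot_list_def)

lemma odot_list_append: "odot_list (xs @ ys) = odot_list xs \<odot> odot_list ys"
  by (induction xs) (auto simp: odot_assoc)

lemma length_odot_list: "length (odot_list ws) = sum_list (map length ws)"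
  by (induction ws) auto

lemma packed_split:
  assumes "packed w" "global_descent w c"
  obtains u v where "packed u" "packed v" "u \<noteq> []" "v \<noteq> []" "w = u \<odot> v"
proof -
  define v where "v = drop c w"
  define u where "u = map (\<lambda>x. x - wmax v) (take c w)"
  have c: "1 \<le> c" "c < length w" and gt: "\<And>x y. x \<in> set (take c w) \<Longrightarrow> y \<in> set v \<Longrightarrow> x > y"
    using assms(2) by (auto simp: global_descent_def v_def)
  have vne: "v \<noteq> []" and une: "u \<noteq> []" using c by (auto simp: v_def u_def)
  have gtm: "x > wmax v" if "x \<in> set (take c w)" for x
    using gt[OF that wmax_in[OF vne]] .
  have un: "set (take c w) \<union> set v = {1..wmax w}"
    using assms(1) by (metis append_take_drop_id packed_def set_append v_def)
  have sv: "set v = {1..wmax v}"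
  proof (intro equalityI subsetI)
    fix x assume "x \<in> set v"
    then show "x \<in> {1..wmax v}" using un wmax_ge[of x v] by auto
  next
    fix x assume x: "x \<in> {1..wmax v}"
    have "wmax v \<le> wmax w" using wmax_in[OF vne] un by auto
    then have "x \<in> set (take c w) \<union> set v" using x un by auto
    then show "x \<in> set v" using gtm[of x] x by auto
  qed
  have su: "set (take c w) = {wmax v + 1..wmax w}"
  proof (intro equalityI subsetI)
    fix x assume "x \<in> set (take c w)"
    then show "x \<in> {wmax v + 1..wmax w}" using un gtm[of x] by auto
  next
    fix x assume x: "x \<in> {wmax v + 1..wmax w}"
    then have "x \<in> set (take c w) \<union> set v" using un by auto
    then show "x \<in> set (take c w)" using x sv by auto
  qed
  have "set u = {1..wmax w - wmax v}"
  proof -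
    have "(\<lambda>x. x - wmax v) ` {wmax v + 1..wmax w} = {1..wmax w - wmax v}"
      by (rule set_eqI, rule iffI) (auto intro!: image_eqI[where x = "_ + wmax v"])
    then show ?thesis by (simp add: u_def su)
  qed
  then have "packed u" using packedI by blast
  moreover have "packed v" using sv by (simp add: packed_def)
  moreover have "shift (wmax v) u = take c w"
    unfolding shift_def u_def map_map o_def
    by (rule map_idI) (use gtm in \<open>auto simp: less_imp_le\<close>)
  then have "w = u \<odot> v" by (simp add: odot_def v_def)
  ultimately show ?thesis using une vne that by blast
qed

lemma irreducible_decomp_exists:
  "packed w \<Longrightarrow> \<exists>ws. (\<forall>x\<in>set ws. irreducible_word x) \<and> odot_list ws = w"
proof (induction "length w" arbitrary: w rule: less_induct)
  case less
  consider "w = []" | "irreducible_word w" | c where "global_descent w c"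
    using less.prems by (auto simp: irreducible_word_def)
  then show ?case
  proof cases
    case 1 then show ?thesis by (intro exI[of _ "[]"]) simp
  next
    case 2 then show ?thesis by (intro exI[of _ "[w]"]) simp
  next
    case 3
    then obtain u v where uv: "packed u" "packed v" "u \<noteq> []" "v \<noteq> []" "w = u \<odot> v"
      using packed_split less.prems by metis
    then obtain us vs where "\<forall>x\<in>set us. irreducible_word x" "odot_list us = u"
      "\<forall>x\<in>set vs. irreducible_word x" "odot_list vs = v"
      using less.hyps[of u] less.hyps[of v] by auto
    then show ?thesis using uv by (intro exI[of _ "us @ vs"]) (auto simp: odot_list_append)
  qed
qed

lemma packed_odot_list: "\<forall>x\<in>set ws. irreducible_word x \<Longrightarrow> packed (odot_list ws)"
  by (induction ws) (auto simp: irreducible_word_def packed_odot)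

lemma global_descent_odot:
  assumes "packed u" "u \<noteq> []" "v \<noteq> []"
  shows "global_descent (u \<odot> v) (length u)"
  using assms wmax_ge[of _ v]
  by (fastforce simp: global_descent_def odot_def set_shift packed_def Suc_le_eq)

lemma global_descent_odotD:
  assumes "global_descent (u \<odot> v) c" "c < length u"
  shows "global_descent u c"
proof -
  have "x + wmax v > y + wmax v" if "x \<in> set (take c u)" "y \<in> set (drop c u)" for x y
  proof -
    have "x + wmax v \<in> set (take c (u \<odot> v))" "y + wmax v \<in> set (drop c (u \<odot> v))"
      using that assms(2) by (simp_all add: odot_def shift_def take_map drop_map)
    then show ?thesis using assms(1) unfolding global_descent_def by blast
  qed
  then show ?thesis using assms by (simp add: global_descent_def)
qed

lemma irreducible_odot_length:
  assumes "irreducible_word u" "irreducible_word u'" "u \<odot> v = u' \<odot> v'"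
  shows "length u' \<le> length u"
proof (rule ccontr)
  assume lt: "\<not> length u' \<le> length u"
  have "length u + length v = length u' + length v'"
    using assms(3) by (metis length_odot)
  then have "v \<noteq> []" using lt by auto
  then have "global_descent (u' \<odot> v') (length u)"
    using global_descent_odot[of u v] assms by (auto simp: irreducible_word_def)
  then have "global_descent u' (length u)" using lt global_descent_odotD by simp
  then show False using assms(2) by (auto simp: irreducible_word_def)
qed

lemma irreducible_decomp_unique:
  assumes "\<forall>x\<in>set us. irreducible_word x" "\<forall>x\<in>set vs. irreducible_word x"
    "odot_list us = odot_list vs"
  shows "us = vs"
  using assms
proof (induction us arbitrary: vs)
  case Nil
  then show ?case by (cases vs) (auto simp: irreducible_word_def odot_def)
next
  case (Cons u us)
  then obtain v vs' where vs: "vs = v # vs'"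
    by (cases vs) (auto simp: irreducible_word_def odot_def shift_def)
  have e: "u \<odot> odot_list us = v \<odot> odot_list vs'" using Cons.prems vs by simp
  have "irreducible_word u" "irreducible_word v" using Cons.prems(1,2) vs by simp_all
  then have "length u = length v"
    by (intro le_antisym irreducible_odot_length[OF _ _ e] irreducible_odot_length[OF _ _ e[symmetric]])
  then have "u = v" and eq: "odot_list us = odot_list vs'" using odot_eq_length[OF e] by auto
  moreover have "us = vs'" by (rule Cons.IH[OF _ _ eq]) (use Cons.prems(1,2) vs in simp_all)
  ultimately show ?case using vs by simp
qed

lemma irreducible_decomp:
  assumes "packed w"
  shows "\<forall>x\<in>set (irreducible_decomp w). irreducible_word x"
    and "odot_list (irreducible_decomp w) = w"
proof -
  have "\<exists>!ws. (\<forall>x\<in>set ws. irreducible_word x) \<and> odot_list ws = w"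
    using irreducible_decomp_exists[OF assms] irreducible_decomp_unique by blast
  from theI'[OF this] show "\<forall>x\<in>set (irreducible_decomp w). irreducible_word x"
    "odot_list (irreducible_decomp w) = w"
    by (auto simp: irreducible_decomp_def)
qed

lemma length_phi [simp]: "length (phi I w) = length w + card I"
  unfolding phi_def by (simp del: upt_Suc)

lemma card_diff_upto:
  "map (\<lambda>i. card ({1..<i} - I)) (filter (\<lambda>i. i \<notin> I) [1..<N + 1]) = [0..<card ({1..N} - I)]"
proof (induction N)
  case (Suc N)
  have *: "{Suc 0..<Suc N} = {Suc 0..N}" by auto
  have "{1..Suc N} - I = (if Suc N \<in> I then {1..N} - I else insert (Suc N) ({1..N} - I))"
    by (auto simp: le_Suc_eq)
  then have "card ({1..Suc N} - I) = (if Suc N \<in> I then card ({1..N} - I) else Suc (card ({1..N} - I)))"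
    by simp
  moreover have "[1..<Suc N + 1] = [1..<N + 1] @ [Suc N]" by simp
  ultimately show ?case using Suc unfolding filter_append map_append by (simp add: * upt_Suc_append[of 0] del: upt_Suc)
qed simp

lemma phi_facts:
  assumes "I \<subseteq> {1..length w + card I}" "I \<noteq> {}"
  shows "filter (\<lambda>x. x \<noteq> wmax w + 1) (phi I w) = w"
    and "wmax (phi I w) = wmax w + 1"
    and "I = {i \<in> {1..length (phi I w)}. phi I w ! (i - 1) = wmax w + 1}"
proof -
  let ?N = "length w + card I"
  let ?f = "\<lambda>i. if i \<in> I then wmax w + 1 else w ! card ({1..<i} - I)"
  have fin: "finite I" using assms(1) finite_subset by blast
  have c: "card ({1..?N} - I) = length w" using assms fin by (simp add: card_Diff_subset)
  have idx: "card ({1..<i} - I) < length w" if "i \<in> {1..?N}" "i \<notin> I" for i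
  proof -
    have "{1..<i} - I \<subset> {1..?N} - I" using that by auto
    then have "card ({1..<i} - I) < card ({1..?N} - I)" by (intro psubset_card_mono) auto
    then show ?thesis using c by simp
  qed
  have le: "w ! card ({1..<i} - I) \<le> wmax w" if "i \<in> {1..?N}" "i \<notin> I" for i
    using idx[OF that] by (simp add: wmax_ge)
  have nth: "phi I w ! (i - 1) = ?f i" if "i \<in> {1..?N}" for i
    proof -
    have "i - 1 < length [1..<?N + 1]" "[1..<?N + 1] ! (i - 1) = i"
      using that by (auto simp del: upt_Suc)
    then show ?thesis unfolding phi_def by (subst nth_map) simp_all
  qed
  have iff: "?f i \<noteq> wmax w + 1 \<longleftrightarrow> i \<notin> I" if "i \<in> {1..?N}" for i
    using le[OF that] by (cases "i \<in> I") auto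
  have "filter (\<lambda>x. x \<noteq> wmax w + 1) (phi I w)
      = map ?f (filter (\<lambda>i. ?f i \<noteq> wmax w + 1) [1..<?N + 1])"
    by (simp add: phi_def filter_map o_def del: upt_Suc)
  also have "filter (\<lambda>i. ?f i \<noteq> wmax w + 1) [1..<?N + 1] = filter (\<lambda>i. i \<notin> I) [1..<?N + 1]"
    
  proof (rule filter_cong[OF refl])
    fix i assume "i \<in> set [1..<?N + 1]"
    then have "i \<in> {1..?N}" by (simp del: upt_Suc)
    then show "?f i \<noteq> wmax w + 1 \<longleftrightarrow> i \<notin> I" by (rule iff)
  qed
  also have "map ?f (filter (\<lambda>i. i \<notin> I) [1..<?N + 1])
      = map ((!) w) (map (\<lambda>i. card ({1..<i} - I)) (filter (\<lambda>i. i \<notin> I) [1..<?N + 1]))"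
    by (simp del: upt_Suc)
  also have "\<dots> = map ((!) w) [0..<length w]" by (simp only: card_diff_upto c)
  also have "\<dots> = w" by (rule map_nth)
  finally show "filter (\<lambda>x. x \<noteq> wmax w + 1) (phi I w) = w" .
  show "I = {i \<in> {1..length (phi I w)}. phi I w ! (i - 1) = wmax w + 1}"
  proof -
    have "phi I w ! (i - 1) = wmax w + 1 \<longleftrightarrow> i \<in> I" if "i \<in> {1..?N}" for i
      unfolding nth[OF that] using iff[OF that] by blast
    then show ?thesis using assms(1) unfolding length_phi by blast
  qed
  obtain i where i: "i \<in> I" "i \<in> {1..?N}" using assms by blast
  show "wmax (phi I w) = wmax w + 1"
  proof (rule wmax_eqI)
    show "x \<le> wmax w + 1" if "x \<in> set (phi I w)" for x
      using that le by (auto simp: phi_def simp del: upt_Suc split: if_splits)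
        (meson atLeastAtMost_iff le_SucI less_Suc_eq_le)
    have "phi I w ! (i - 1) \<in> set (phi I w)" using i by (intro nth_mem) auto
    then show "wmax w + 1 \<in> insert 0 (set (phi I w))" using nth[OF i(2)] i by simp
  qed
qed

lemma is_phi_decomp_unique:
  assumes "is_phi_decomp v I v'" "is_phi_decomp v J v''"
  shows "I = J \<and> v' = v''"
proof -
  have a: "I \<subseteq> {1..length v' + card I}" "I \<noteq> {}" "phi I v' = v"
    "J \<subseteq> {1..length v'' + card J}" "J \<noteq> {}" "phi J v'' = v"
    using assms by (auto simp: is_phi_decomp_def)
  note p = phi_facts[OF a(1,2), unfolded a] and q = phi_facts[OF a(4,5), unfolded a]
  have m: "wmax v' + 1 = wmax v''+ 1" using p(2) q(2) by simp
  have "v' = v''" using p(1) q(1) unfolding m by simp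
  moreover have "I = J" using p(3) q(3) unfolding m by simp
  ultimately show ?thesis by simp
qed

lemma nth_filter_take:
  assumes "k < length v" "P (v ! k)"
  shows "filter P v ! length (filter P (take k v)) = v ! k"
proof -
  have "filter P v = filter P (take k v) @ v ! k # filter P (drop (Suc k) v)"
    by (subst id_take_nth_drop[OF assms(1)]) (simp add: assms)
  then show ?thesis by (metis nth_append_length)
qed

lemma is_phi_decomp_exists:
  assumes "packed v" "v \<noteq> []"
  shows "is_phi_decomp v {i \<in> {1..length v}. v ! (i - 1) = wmax v} (filter (\<lambda>x. x \<noteq> wmax v) v)"
    (is "is_phi_decomp v ?I ?v'")
proof -
  have card_I: "card ({1..<i} - ?I) = length (filter (\<lambda>x. x \<noteq> wmax v) (take (i - 1) v))"
    if "i \<le> length v + 1" "i \<ge> 1" for i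
  proof -
    have "{1..<i} - ?I = Suc ` {k. k < length (take (i - 1) v) \<and> take (i - 1) v ! k \<noteq> wmax v}"
      (is "?A = Suc ` ?B")
    proof (intro equalityI subsetI)
      fix x assume "x \<in> ?A"
      then have "x = Suc (x - 1)" "x - 1 \<in> ?B" using that by auto
      then show "x \<in> Suc ` ?B" by blast
    qed (use that in auto)
    then show ?thesis by (simp add: length_filter_conv_card card_image)
  qed
  have m: "set v = {1..wmax v}" "wmax v \<ge> 1"
    using assms wmax_in[of v] by (auto simp: packed_def)
  have "set ?v' = {1..wmax v - 1}" using m by auto
  then have v': "packed ?v'" "wmax ?v' = wmax v - 1" using packedI by blast+
  have "{1..<length v + 1} - ?I = {1..length v} - ?I" by auto
  then have "card ({1..length v} - ?I) = length ?v'" using card_I[of "length v + 1"] by simp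
  moreover have "card ({1..length v} - ?I) = length v - card ?I"
    by (subst card_Diff_subset) auto
  moreover have "card ?I \<le> length v" 
  proof -
    have "card ?I \<le> card {1..length v}" by (rule card_mono) auto
    then show ?thesis by simp
  qed
  ultimately have len: "length ?v' + card ?I = length v" by simp
  have "phi ?I ?v' = v"
  proof (rule nth_equalityI)
    show "length (phi ?I ?v') = length v" using len by simp
    fix k assume "k < length (phi ?I ?v')"
    then have k: "k < length v" using len by simp
    have "phi ?I ?v' ! k = (if Suc k \<in> ?I then wmax ?v' + 1 else ?v' ! card ({1..<Suc k} - ?I))"
      using k unfolding phi_def len by (simp del: upt_Suc)
    also have "\<dots> = v ! k"
    proof (cases "v ! k = wmax v")
      case True
      then have "Suc k \<in> ?I" using k by simp
      then show ?thesis using v' m True by simp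
    next
      case False
      then have n: "Suc k \<notin> ?I" by simp
      have e: "?v' ! card ({1..<Suc k} - ?I) = v ! k"
        using card_I[of "Suc k"] k nth_filter_take[of k v "\<lambda>x. x \<noteq> wmax v"] False by simp
      show ?thesis by (subst if_not_P[OF n]) (rule e)
    qed
    finally show "phi ?I ?v' ! k = v ! k" .
  qed
  moreover have "?I \<noteq> {}"
  proof -
    obtain k where "k < length v" "v ! k = wmax v"
      using wmax_in[OF assms(2)] by (auto simp: in_set_conv_nth)
    then have "Suc k \<in> ?I" by simp
    then show ?thesis by blast
  qed
  moreover have "?I \<subseteq> {1..length ?v' + card ?I}" unfolding len by auto
  ultimately show ?thesis using v' unfolding is_phi_decomp_def by simp
qed

lemma phi_decomp_eqI: "is_phi_decomp v I v' \<Longrightarrow> phi_decomp v = (I, v')"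
  unfolding phi_decomp_def by (rule the_equality) (auto dest: is_phi_decomp_unique)

lemma phi_decompE:
  assumes "packed v" "v \<noteq> []"
  obtains I v' where "phi_decomp v = (I, v')" "is_phi_decomp v I v'"
  using is_phi_decomp_exists[OF assms] phi_decomp_eqI by blast

lemma is_tri_R_factE:
  assumes "is_tri_R_fact w u v"
  obtains I v' where "is_phi_decomp v I v'" "phi_decomp v = (I, v')"
    "is_phi_decomp w ((\<lambda>i. i + length u) ` I) (u \<odot> v')"
proof -
  have a: "packed u" "packed v" "v \<noteq> []" "w = u \<triangleleft>\<^sub>R v"
    using assms by (auto simp: is_tri_R_fact_def)
  obtain I v' where I: "phi_decomp v = (I, v')" "is_phi_decomp v I v'"
    using phi_decompE[OF a(2,3)] .
  have c: "card ((\<lambda>i. i + length u) ` I) = card I" by (simp add: card_image)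
  have "is_phi_decomp w ((\<lambda>i. i + length u) ` I) (u \<odot> v')"
    using I a unfolding is_phi_decomp_def c by (auto simp: tri_R_def packed_odot)
  then show ?thesis using that I by blast
qed

lemma is_tri_R_fact_length:
  assumes "is_tri_R_fact w u v"
  shows "length w = length u + length v"
proof -
  obtain I v' where "is_phi_decomp v I v'"
    "is_phi_decomp w ((\<lambda>i. i + length u) ` I) (u \<odot> v')"
    using is_tri_R_factE[OF assms] by metis
  then show ?thesis by (auto simp: is_phi_decomp_def card_image)
qed

lemma is_tri_R_fact_unique:
  assumes "is_tri_R_fact w u v" "is_tri_R_fact w x y" "length u = length x"
  shows "u = x \<and> v = y"
proof -
  obtain I v' where I: "is_phi_decomp v I v'"
    "is_phi_decomp w ((\<lambda>i. i + length u) ` I) (u \<odot> v')"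
    using is_tri_R_factE[OF assms(1)] by metis
  obtain J y' where J: "is_phi_decomp y J y'"
    "is_phi_decomp w ((\<lambda>i. i + length x) ` J) (x \<odot> y')"
    using is_tri_R_factE[OF assms(2)] by metis
  have "(\<lambda>i. i + length u) ` I = (\<lambda>i. i + length u) ` J" "u \<odot> v' = x \<odot> y'"
    using is_phi_decomp_unique[OF I(2) J(2)] assms(3) by auto
  then have "I = J" "u = x" "v' = y'"
    using odot_eq_length[of u v' x y'] assms(3) by (auto simp: inj_image_eq_iff)
  then show ?thesis using I(1) J(1) by (simp add: is_phi_decomp_def)
qed

lemma is_red_fact_ex1:
  assumes "packed w" "w \<noteq> []"
  shows "\<exists>!p. case p of (u, v) \<Rightarrow> is_red_fact w u v"
proof -
  obtain I w' where "phi_decomp w = (I, w')" "is_phi_decomp w I w'"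
    using phi_decompE[OF assms] .
  then have "is_tri_R_fact w [] w"
    using assms by (auto simp: is_tri_R_fact_def tri_R_def is_phi_decomp_def)
  then have "\<exists>p. (case p of (u, v) \<Rightarrow> is_tri_R_fact w u v) \<and>
      (\<forall>q. (case q of (u, v) \<Rightarrow> is_tri_R_fact w u v) \<longrightarrow> length (fst q) \<le> length (fst p))"
    by (intro ex_has_greatest_nat[where k = "([], w)" and b = "length w + 1"])
      (auto dest: is_tri_R_fact_length)
  then have "\<exists>p. case p of (u, v) \<Rightarrow> is_red_fact w u v"
    by (auto simp: is_red_fact_def)
  moreover have "u = x \<and> v = y" if "is_red_fact w u v" "is_red_fact w x y" for u v x y
    using that is_tri_R_fact_unique[of w u v x y] unfolding is_red_fact_def
    by (meson le_antisym)
  ultimately show ?thesis by fast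
qed

lemma red_factE:
  assumes "irreducible_word w"
  obtains u v where "red_fact w = (u, v)" "is_red_fact w u v"
proof -
  have "case red_fact w of (u, v) \<Rightarrow> is_red_fact w u v"
    unfolding red_fact_def
    by (rule theI'[OF is_red_fact_ex1]) (use assms in \<open>auto simp: irreducible_word_def\<close>)
  then show ?thesis using that by (cases "red_fact w") auto
qed

text \<open>Outside their domains (packed words, irreducible words) both maps are left unspecified.\<close>

function (sequential)
  F_R :: "word \<Rightarrow> nat set biplane_forest" and
  T_R :: "word \<Rightarrow> nat set biplane_tree" where
  "F_R w = (if packed w then map T_R (irreducible_decomp w) else undefined)"
| "T_R w = (if irreducible_word w
            then (case red_fact w of (u, v) \<Rightarrow>
                  (case phi_decomp v of (I, v') \<Rightarrow> Node I (F_R u) (F_R v')))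
            else undefined)"
  by pat_completeness auto
termination
proof (relation "measure (case_sum (\<lambda>w. 2 * length w + 1) (\<lambda>w. 2 * length w))", goal_cases)
  case 1 show ?case by simp
next
  case (2 w x)
  then have "length x \<le> sum_list (map length (irreducible_decomp w))"
    by (simp add: member_le_sum_list)
  also have "\<dots> = length w"
    using irreducible_decomp(2)[OF 2(1)] by (metis length_odot_list)
  finally show ?case by simp
next
  case (3 w u v I v')
  then have "is_tri_R_fact w u v"
    using red_factE[OF 3(1)] by (metis is_red_fact_def prod.inject)
  then show ?case using is_tri_R_fact_length[of w u v] by (cases v) (auto simp: is_tri_R_fact_def)
next
  case (4 w u v I v')
  then have f: "is_tri_R_fact w u v"
    using red_factE[OF 4(1)] by (metis is_red_fact_def prod.inject)
  then have "is_phi_decomp v I v'"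
    using 4(3) is_tri_R_factE[OF f] by (metis prod.inject)
  then have "length v = length v' + card I" "I \<subseteq> {1..length v' + card I}" "I \<noteq> {}"
    by (auto simp: is_phi_decomp_def)
  moreover from this have "card I > 0" by (metis card_gt_0_iff finite_atLeastAtMost finite_subset)
  ultimately show ?case using is_tri_R_fact_length[OF f] by simp
qed

declare F_R.simps [simp del] T_R.simps [simp del] F_R_star.simps [simp del] T_R_star.simps [simp del]

end

theory Submission
  imports Defs
begin

text \<open>Write a nonempty packed word as \<open>w = phi J w'\<close> and decompose \<open>w' = x\<^sub>1 \<odot> \<dots> \<odot> x\<^sub>m\<close> into
  irreducibles. The maximal letters of \<open>w\<close> lie to the left of every global descent, and removing
  them turns a global descent of \<open>w\<close> into one of \<open>w'\<close> (or into position 0). Hence, for \<open>m \<ge> 1\<close>, \<open>w\<close>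
  is irreducible iff its last maximal letter lies beyond the start of the block \<open>x\<^sub>m\<close>. The
  factorizations \<open>w = u \<triangleleft>\<^sub>R v\<close> come from the prefixes \<open>u = x\<^sub>1 \<odot> \<dots> \<odot> x\<^sub>a\<close> ending before the first
  maximal letter, so \<open>u\<close> is the longest one iff, inside \<open>v\<close>, the first maximal letter occurs before
  the end of the next block. These are exactly the two inequalities for red-packed trees, and
  both inverse laws then follow by induction along the recursions.\<close>

section \<open>Recovering \<open>I\<close> and the remaining word from the maximal letters\<close>

lemma set_phi:
  assumes "I \<subseteq> {1..length w + card I}" "I \<noteq> {}"
  shows "set (phi I w) = insert (wmax w + 1) (set w)"
proof -
  have "set (filter (\<lambda>x. x \<noteq> wmax w + 1) (phi I w)) = set w"
    using phi_facts(1)[OF assms] by simp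
  moreover have "wmax w + 1 \<in> set (phi I w)"
    using wmax_in[of "phi I w"] phi_facts(2)[OF assms] by (cases "phi I w = []") auto
  ultimately show ?thesis by auto
qed

lemma is_phi_decomp_packed:
  assumes "is_phi_decomp v I v'"
  shows "packed v" "v \<noteq> []" "length v = length v' + card I" "wmax v = wmax v' + 1"
    "filter (\<lambda>x. x \<noteq> wmax v) v = v'" "finite I" "I = {i \<in> {1..length v}. v ! (i - 1) = wmax v}"
proof -
  have a: "I \<subseteq> {1..length v' + card I}" "I \<noteq> {}" "v = phi I v'" "packed v'"
    using assms by (auto simp: is_phi_decomp_def)
  note f = phi_facts[OF a(1,2), folded a(3)]
  show "length v = length v' + card I" using a by simp
  show m: "wmax v = wmax v' + 1" by (fact f)
  show "filter (\<lambda>x. x \<noteq> wmax v) v = v'" "I = {i \<in> {1..length v}. v ! (i - 1) = wmax v}"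
    using f m by simp_all
  show "finite I" using a(1) finite_subset by blast
  have "set v = {1..wmax v}"
    using set_phi[OF a(1,2)] a(3,4) m by (auto simp: packed_def)
  then show "packed v" by (simp add: packed_def)
  show "v \<noteq> []" using m by auto
qed

section \<open>Irreducibility and the last maximal letter\<close>

lemma wmax_notin_drop_iff:
  assumes "is_phi_decomp w J w'"
  shows "wmax w \<notin> set (drop c w) \<longleftrightarrow> Max J \<le> c"
proof -
  note d = is_phi_decomp_packed[OF assms]
  have "J \<noteq> {}" using assms by (simp add: is_phi_decomp_def)
  then have "Max J \<le> c \<longleftrightarrow> (\<forall>j\<in>J. j \<le> c)" using d(6) by simp
  also have "\<dots> \<longleftrightarrow> wmax w \<notin> set (drop c w)"
  proof
    assume a: "\<forall>j\<in>J. j \<le> c"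
    show "wmax w \<notin> set (drop c w)"
    proof
      assume "wmax w \<in> set (drop c w)"
      then obtain k where "k < length w - c" "w ! (c + k) = wmax w"
        by (auto simp: in_set_conv_nth)
      \<comment> \<open>Positions in \<open>J\<close> count from 1, list indices from 0.\<close>
      then have "c + k + 1 \<in> J" by (subst d(7)) auto
      then show False using a by force
    qed
  next
    assume a: "wmax w \<notin> set (drop c w)"
    show "\<forall>j\<in>J. j \<le> c"
    proof (rule ballI, rule ccontr)
      fix j assume j: "j \<in> J" "\<not> j \<le> c"
      then have "1 \<le> j" "j \<le> length w" "w ! (j - 1) = wmax w"
        using subsetD[OF equalityD1[OF d(7)] j(1)] by auto
      then have "drop c w ! (j - 1 - c) = wmax w" "j - 1 - c < length (drop c w)"
        using j(2) by auto
      then show False using a nth_mem by metis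
    qed
  qed
  finally show ?thesis by blast
qed

text \<open>The threshold is the length of the prefix left when a suffix of length
  \<open>length x\<close> is cut off \<open>w\<close>. If it contains all maximal letters, the
  suffix is \<open>x\<close> and the cut is a global descent. Otherwise every global descent of
  \<open>w\<close> lies beyond the threshold and would give one of \<open>x\<close>. As
  \<open>y\<close> may be any packed word, the left factor of a factorization can later be absorbed
  into it.\<close>

lemma irreducible_phi_iff:
  assumes w: "is_phi_decomp w J (y \<odot> x)" and "packed y" "irreducible_word x"
  shows "irreducible_word w \<longleftrightarrow> length y + card J < Max J"
proof -
  note d = is_phi_decomp_packed[OF w]
  let ?P = "\<lambda>z. z \<noteq> wmax w"
  have x: "packed x" "x \<noteq> []" using assms(3) by (auto simp: irreducible_word_def)
  \<comment> \<open>With no maximal letter after the cut, deleting these letters changes only the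
    part before it.\<close>
  have split: "filter ?P (take c w) @ drop c w = y \<odot> x" if "wmax w \<notin> set (drop c w)" for c
  proof -
    have "filter ?P (drop c w) = drop c w" using that by (auto simp: filter_id_conv)
    then show ?thesis using d(5) filter_append[of ?P "take c w" "drop c w"] by simp
  qed
  show ?thesis
  proof
    assume irr: "irreducible_word w"
    show "length y + card J < Max J"
    proof (rule ccontr)
      define c where "c = length y + card J"
      assume "\<not> length y + card J < Max J"
      then have m: "Max J \<le> c" by (simp add: c_def)
      then have n: "wmax w \<notin> set (drop c w)" using wmax_notin_drop_iff[OF w] by simp
      have len: "length (drop c w) = length x" using d(3) by (simp add: c_def)
      have e: "filter ?P (take c w) = shift (wmax x) y" "drop c w = x"
        using split[OF n] len by (auto simp: odot_def append_eq_append_conv)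
      \<comment> \<open>This ensures \<open>1 \<le> c\<close> even for empty
        \<open>y\<close>.\<close>
      have "0 < card J" using d(6) w by (auto simp: is_phi_decomp_def card_gt_0_iff)
      then have c: "1 \<le> c" "c < length w" using d(3) x by (auto simp: c_def)
      have "a > wmax x" if "a \<in> set (take c w)" for a
      proof (cases "a = wmax w")
        case True then show ?thesis using d(4) by (simp add: wmax_odot)
      next
        case False
        then have "a \<in> set (shift (wmax x) y)" using that e(1)[symmetric] by auto
        then show ?thesis using assms(2) by (auto simp: set_shift packed_def)
      qed
      then have "global_descent w c"
        using c e(2) wmax_ge[of _ x] by (fastforce simp: global_descent_def)
      then show False using irr by (auto simp: irreducible_word_def)
    qed
  next
    assume lt: "length y + card J < Max J"
    have False if g: "global_descent w c" for c
    proof -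
      have c: "1 \<le> c" "c < length w"
        and gt: "\<And>a b. a \<in> set (take c w) \<Longrightarrow> b \<in> set (drop c w) \<Longrightarrow> b < a"
        using g by (auto simp: global_descent_def)
      \<comment> \<open>A maximal letter after a global descent would have to be smaller than the
        first letter.\<close>
      have n: "wmax w \<notin> set (drop c w)"
      proof
        assume a: "wmax w \<in> set (drop c w)"
        have "w ! 0 \<in> set (take c w)" using c by (auto simp: in_set_conv_nth intro!: exI[of _ 0])
        then have "wmax w < w ! 0" "w ! 0 \<in> set w" using gt a in_set_takeD by fast+
        then show False using wmax_ge[of "w ! 0" w] by simp
      qed
      then have ge: "length y + card J < c" using lt wmax_notin_drop_iff[OF w] by force
      \<comment> \<open>All maximal letters and all of \<open>y\<close> come before the cut, so
        \<open>k\<close> counts the letters of \<open>x\<close> before it.\<close>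
      define k where "k = c - card J - length y"
      have "length (filter ?P (take c w)) + (length w - c) = length y + length x"
        using arg_cong[OF split[OF n], of length] by simp
      then have lf: "length (filter ?P (take c w)) = length y + k"
        using ge c d(3) by (simp add: k_def)
      have "x = drop (length y) (y \<odot> x)" by (simp add: odot_def)
      also have "\<dots> = drop (length y) (filter ?P (take c w)) @ drop c w"
        using lf by (simp flip: split[OF n])
      finally have xe: "x = drop (length y) (filter ?P (take c w)) @ drop c w" .
      have "length (drop (length y) (filter ?P (take c w))) = k" using lf by simp
      then have "take k x = drop (length y) (filter ?P (take c w))" "drop k x = drop c w"
        by (subst xe, simp)+
      then have "set (take k x) \<subseteq> set (take c w)" "drop k x = drop c w"
        using set_drop_subset[of "length y" "filter ?P (take c w)"] by auto
      moreover have "1 \<le> k" "k < length x" using ge c d(3) by (auto simp: k_def)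
      ultimately have "global_descent x k" using gt unfolding global_descent_def by auto
      then show False using assms(3) by (auto simp: irreducible_word_def)
    qed
    then show "irreducible_word w" using d by (auto simp: irreducible_word_def)
  qed
qed

text \<open>Supplies the case of an empty remaining word, where there is no last block for
  \<open>irreducible_phi_iff\<close>: after any cut stands the maximal last letter, which the first
  letter cannot exceed.\<close>

lemma irreducible_phi_last:
  assumes w: "is_phi_decomp w J w'" and M: "Max J = length w"
  shows "irreducible_word w"
proof -
  note d = is_phi_decomp_packed[OF w]
  have False if g: "global_descent w c" for c
  proof -
    have c: "1 \<le> c" "c < length w" using g by (auto simp: global_descent_def)
    then have "wmax w \<in> set (drop c w)" using wmax_notin_drop_iff[OF w, of c] M by auto
    moreover have "w ! 0 \<in> set (take c w)"
      using c by (auto simp: in_set_conv_nth intro!: exI[of _ 0])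
    ultimately have "wmax w < w ! 0" using g unfolding global_descent_def by blast
    then show False using wmax_ge[of "w ! 0" w] d(2) by simp
  qed
  then show ?thesis using d by (auto simp: irreducible_word_def)
qed

section \<open>Red-factorizations and the first maximal letter\<close>

lemma tri_R_phi:
  assumes "packed u" "is_phi_decomp v I v'"
  shows "is_tri_R_fact (u \<triangleleft>\<^sub>R v) u v"
    and "is_phi_decomp (u \<triangleleft>\<^sub>R v) ((\<lambda>i. i + length u) ` I) (u \<odot> v')"
proof -
  show f: "is_tri_R_fact (u \<triangleleft>\<^sub>R v) u v"
    using assms(1) is_phi_decomp_packed(1,2)[OF assms(2)] by (simp add: is_tri_R_fact_def)
  show "is_phi_decomp (u \<triangleleft>\<^sub>R v) ((\<lambda>i. i + length u) ` I) (u \<odot> v')"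
    using is_tri_R_factE[OF f] phi_decomp_eqI[OF assms(2)] by (metis prod.inject)
qed

lemma global_descent_odot_right:
  assumes "global_descent (u \<odot> x) c" "length u < c"
  shows "global_descent x (c - length u)"
  using assms by (auto simp: global_descent_def odot_def)

text \<open>When the block \<open>x\<close> ends before the first maximal letter, \<open>z\<close>
  alone can carry the maximal letters at positions lowered by \<open>length x\<close>. This allows
  \<open>x\<close> to be moved into the left factor.\<close>

lemma is_phi_decomp_shift_index:
  assumes "is_phi_decomp v I (x \<odot> z)" "packed z" "length x < Min I"
  obtains K where "I = (\<lambda>i. i + length x) ` K" "is_phi_decomp (phi K z) K z"
proof
  let ?K = "(\<lambda>i. i - length x) ` I"
  have I: "I \<noteq> {}" "I \<subseteq> {1..length x + length z + card I}" "finite I"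
    using assms(1) is_phi_decomp_packed(6)[OF assms(1)] by (auto simp: is_phi_decomp_def)
  have gt: "length x < i" if "i \<in> I" for i
    using assms(3) I that by (meson Min_le less_le_trans)
  show e: "I = (\<lambda>i. i + length x) ` ?K"
    using gt by (force simp: image_image)
  have "card I = card ?K" by (subst e) (simp add: card_image)
  then show "is_phi_decomp (phi ?K z) ?K z"
    using I gt assms(2) unfolding is_phi_decomp_def by fastforce
qed

text \<open>The hypotheses amount to \<open>v = x \<triangleleft>\<^sub>R y\<close>, so this is the
  mixed associativity of \<open>\<odot>\<close> and \<open>\<triangleleft>\<^sub>R\<close>.\<close>

lemma tri_R_assoc_phi:
  assumes "packed u" "packed x" "is_phi_decomp v I (x \<odot> z)"
    "I = (\<lambda>i. i + length x) ` K" "is_phi_decomp y K z"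
  shows "(u \<odot> x) \<triangleleft>\<^sub>R y = u \<triangleleft>\<^sub>R v"
proof -
  have "(\<lambda>i. i + length u) ` I = (\<lambda>i. i + length (u \<odot> x)) ` K"
    using assms(4) by (simp add: image_image add_ac)
  then show ?thesis
    using phi_decomp_eqI[OF assms(3)] phi_decomp_eqI[OF assms(5)]
    by (simp add: tri_R_def odot_assoc)
qed

text \<open>If the first maximal letter lies beyond \<open>x\<close>, the left factor can grow to
  \<open>u \<odot> x\<close>. Otherwise a longer left factor would end strictly inside
  \<open>x\<close>, and its end would be a global descent of \<open>x\<close>.\<close>

lemma is_red_fact_iff:
  assumes u: "packed u" and v: "is_phi_decomp v I (x \<odot> z)"
    and x: "irreducible_word x" and z: "packed z"
  shows "is_red_fact (u \<triangleleft>\<^sub>R v) u v \<longleftrightarrow> Min I \<le> length x"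
proof
  assume r: "is_red_fact (u \<triangleleft>\<^sub>R v) u v"
  show "Min I \<le> length x"
  proof (rule ccontr)
    assume "\<not> Min I \<le> length x"
    then obtain K where K: "I = (\<lambda>i. i + length x) ` K" "is_phi_decomp (phi K z) K z"
      using is_phi_decomp_shift_index[OF v z] by auto
    have px: "packed x" "x \<noteq> []" using x by (auto simp: irreducible_word_def)
    have "is_tri_R_fact (u \<triangleleft>\<^sub>R v) (u \<odot> x) (phi K z)"
      using tri_R_phi(1)[OF packed_odot[OF u px(1)] K(2)] tri_R_assoc_phi[OF u px(1) v K] by simp
    then have "length (u \<odot> x) \<le> length u" using r by (auto simp: is_red_fact_def)
    then show False using px by simp
  qed
next
  assume le: "Min I \<le> length x"
  have I: "finite I" "I \<noteq> {}"
    using v is_phi_decomp_packed(6)[OF v] by (auto simp: is_phi_decomp_def)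
  have "length s \<le> length u" if f: "is_tri_R_fact (u \<triangleleft>\<^sub>R v) s t" for s t
  proof (rule ccontr)
    assume lt: "\<not> length s \<le> length u"
    obtain K t' where K: "is_phi_decomp t K t'"
      "is_phi_decomp (u \<triangleleft>\<^sub>R v) ((\<lambda>i. i + length s) ` K) (s \<odot> t')"
      using is_tri_R_factE[OF f] by metis
    have e: "(\<lambda>i. i + length u) ` I = (\<lambda>i. i + length s) ` K" "(u \<odot> x) \<odot> z = s \<odot> t'"
      using is_phi_decomp_unique[OF tri_R_phi(2)[OF u v] K(2)] by (auto simp: odot_assoc)
    \<comment> \<open>The first maximal position is some \<open>k + length s\<close> with
      \<open>k \<ge> 1\<close>, so \<open>s\<close> ends before it and hence inside
      \<open>u \<odot> x\<close>.\<close>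
    have "Min I + length u \<in> (\<lambda>i. i + length s) ` K" using I by (simp flip: e(1))
    moreover have "\<forall>k\<in>K. 1 \<le> k" using K(1) by (auto simp: is_phi_decomp_def)
    ultimately have s: "length s < length (u \<odot> x)" using le by auto
    have "s \<noteq> []" "t' \<noteq> []" using lt s arg_cong[OF e(2), of length] by auto
    then have "global_descent ((u \<odot> x) \<odot> z) (length s)"
      using f e(2) global_descent_odot[of s t'] by (simp add: is_tri_R_fact_def)
    then have "global_descent (u \<odot> x) (length s)" using s by (rule global_descent_odotD)
    then have "global_descent x (length s - length u)"
      using lt by (intro global_descent_odot_right) auto
    then show False using x by (auto simp: irreducible_word_def)
  qed
  then show "is_red_fact (u \<triangleleft>\<^sub>R v) u v"
    using tri_R_phi(1)[OF u v] by (auto simp: is_red_fact_def)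
qed

text \<open>No block is left to move: every factorization gives \<open>s \<odot> t' = u\<close>, so
  \<open>s\<close> is not longer than \<open>u\<close>.\<close>

lemma is_red_fact_phi_Nil:
  assumes u: "packed u" and v: "is_phi_decomp v I []"
  shows "is_red_fact (u \<triangleleft>\<^sub>R v) u v"
proof -
  have "length s \<le> length u" if f: "is_tri_R_fact (u \<triangleleft>\<^sub>R v) s t" for s t
  proof -
    obtain K t' where "is_phi_decomp (u \<triangleleft>\<^sub>R v) ((\<lambda>i. i + length s) ` K) (s \<odot> t')"
      using is_tri_R_factE[OF f] by metis
    then have "u \<odot> [] = s \<odot> t'"
      using is_phi_decomp_unique[OF tri_R_phi(2)[OF u v]] by blast
    then show ?thesis by (metis length_odot le_add1 odot_Nil(2))
  qed
  then show ?thesis using tri_R_phi(1)[OF u v] by (auto simp: is_red_fact_def)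
qed

text \<open>The bridge between words and trees: the right side is the red-packed condition with
  block lengths for weights and the last inequality made strict over the naturals. The outer bounds
  on \<open>I\<close>, and \<open>I = {1..card I}\<close> for empty \<open>v'\<close>, already
  follow from \<open>is_phi_decomp\<close>.\<close>

lemma irreducible_red_fact_iff:
  assumes u: "packed u" and v: "is_phi_decomp v I v'"
  defines "ws \<equiv> irreducible_decomp v'"
  shows "irreducible_word (u \<triangleleft>\<^sub>R v) \<and> is_red_fact (u \<triangleleft>\<^sub>R v) u v \<longleftrightarrow>
    ws = [] \<or> ws \<noteq> [] \<and> Min I \<le> length (hd ws) \<and>
      card I + length v' < length (last ws) + Max I"
proof -
  have v': "packed v'" using v by (simp add: is_phi_decomp_def)
  have ws: "\<forall>x\<in>set ws. irreducible_word x" "odot_list ws = v'"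
    using irreducible_decomp[OF v'] by (simp_all add: ws_def)
  let ?J = "(\<lambda>i. i + length u) ` I"
  note w = tri_R_phi(2)[OF u v]
  note d = is_phi_decomp_packed[OF v]
  have I: "I \<noteq> {}" "finite I" "I \<subseteq> {1..length v' + card I}"
    using v d(6) by (auto simp: is_phi_decomp_def)
  have M: "Max ?J = Max I + length u"
    using I by (simp add: mono_Max_commute[symmetric] mono_def)
  have c: "card ?J = card I" by (simp add: card_image)
  show ?thesis
  proof (cases "ws = []")
    case True
    then have "v' = []" using ws by simp
    then have "I = {1..card I}" using I by (intro card_subset_eq) auto
    moreover have "1 \<le> card I" using I by (simp add: Suc_le_eq card_gt_0_iff)
    ultimately have "Max I = card I" using Max_in[of I] I
      by (metis Max_ge atLeastAtMost_iff le_antisym order_refl)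
    then have "irreducible_word (u \<triangleleft>\<^sub>R v)"
      using M c \<open>v' = []\<close> is_phi_decomp_packed(3)[OF w] by (intro irreducible_phi_last[OF w]) simp
    then show ?thesis using True is_red_fact_phi_Nil[OF u] v \<open>v' = []\<close> by simp
  next
    case False
    \<comment> \<open>Splitting off the first block decides maximality of \<open>u\<close>;
      splitting off the last block, with \<open>u\<close> joined to the prefix, decides
      irreducibility.\<close>
    have hd: "v' = hd ws \<odot> odot_list (tl ws)"
      using ws(2) False by (metis list.collapse odot_list_Cons)
    have last: "v' = odot_list (butlast ws) \<odot> last ws"
      using ws(2) False odot_list_append[of "butlast ws" "[last ws]"] by simp
    have irr: "irreducible_word (hd ws)" "irreducible_word (last ws)"
      using ws(1) False by auto
    have p: "packed (odot_list (tl ws))" "packed (odot_list (butlast ws))"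
      using ws(1) by (auto intro!: packed_odot_list dest: in_set_butlastD list.set_sel(2)[OF False])
    have "is_red_fact (u \<triangleleft>\<^sub>R v) u v \<longleftrightarrow> Min I \<le> length (hd ws)"
      using is_red_fact_iff[OF u _ irr(1) p(1)] v hd by metis
    moreover have "irreducible_word (u \<triangleleft>\<^sub>R v) \<longleftrightarrow>
        length (u \<odot> odot_list (butlast ws)) + card ?J < Max ?J"
    proof (rule irreducible_phi_iff[OF _ packed_odot[OF u p(2)] irr(2)])
      show "is_phi_decomp (u \<triangleleft>\<^sub>R v) ?J ((u \<odot> odot_list (butlast ws)) \<odot> last ws)"
        using w last by (simp add: odot_assoc)
    qed
    moreover have "length v' = length (odot_list (butlast ws)) + length (last ws)"
      using arg_cong[OF last, of length] by simp
    ultimately show ?thesis using False M c by auto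
  qed
qed

section \<open>The two inverse laws\<close>

lemma irreducible_decomp_eqI:
  assumes "\<forall>x\<in>set ws. irreducible_word x"
  shows "irreducible_decomp (odot_list ws) = ws"
  using irreducible_decomp[OF packed_odot_list[OF assms]] assms
  by (intro irreducible_decomp_unique) auto

lemma red_fact_eqI:
  assumes "irreducible_word w" "is_red_fact w u v"
  shows "red_fact w = (u, v)"
proof -
  have "\<exists>!p. case p of (u, v) \<Rightarrow> is_red_fact w u v"
    using is_red_fact_ex1 assms(1) by (simp add: irreducible_word_def)
  then show ?thesis unfolding red_fact_def by (rule the1_equality) (use assms(2) in simp)
qed

text \<open>The lists of weights and block lengths are compared entry by entry, not only in total,
  because the red-packed condition refers to the first and last tree of the right forest.\<close>

lemma F_R_T_R_correct:
  "packed w \<Longrightarrow> red_packed_forest (F_R w) \<and> map weight (F_R w) = map length (irreducible_decomp w)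
    \<and> F_R_star (F_R w) = w"
  "irreducible_word w' \<Longrightarrow> red_packed_tree (T_R w') \<and> weight (T_R w') = length w'
    \<and> T_R_star (T_R w') = w'"
proof (induction w and w' rule: F_R_T_R.induct)
  case (1 w)
  note d = irreducible_decomp[OF "1.prems"]
  have e: "F_R w = map T_R (irreducible_decomp w)" using "1.prems" by (simp add: F_R.simps)
  have IH: "red_packed_tree (T_R x) \<and> weight (T_R x) = length x \<and> T_R_star (T_R x) = x"
    if "x \<in> set (irreducible_decomp w)" for x
    using "1.IH"[OF "1.prems" that] d(1) that by blast
  have "map T_R_star (map T_R (irreducible_decomp w)) = irreducible_decomp w"
    using IH by (simp add: map_idI)
  then have "F_R_star (F_R w) = w" using d(2) by (simp add: e F_R_star.simps)
  then show ?case using IH by (auto simp: e red_packed_forest_def)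
next
  case (2 w)
  obtain u v where uv: "red_fact w = (u, v)" "is_red_fact w u v" using red_factE[OF "2.prems"] .
  then have f: "is_tri_R_fact w u v" by (simp add: is_red_fact_def)
  then have u: "packed u" "packed v" "v \<noteq> []" and w: "w = u \<triangleleft>\<^sub>R v" by (auto simp: is_tri_R_fact_def)
  obtain I v' where I: "phi_decomp v = (I, v')" "is_phi_decomp v I v'" using phi_decompE[OF u(2,3)] .
  then have v': "packed v'" "v = phi I v'" "I \<noteq> {}" "I \<subseteq> {1..length v' + card I}"
    by (auto simp: is_phi_decomp_def)
  note d = is_phi_decomp_packed[OF I(2)]
  have e: "T_R w = Node I (F_R u) (F_R v')" using "2.prems" uv I by (simp add: T_R.simps)
  have IHu: "red_packed_forest (F_R u)" "map weight (F_R u) = map length (irreducible_decomp u)"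
      "F_R_star (F_R u) = u"
    and IHv: "red_packed_forest (F_R v')" "map weight (F_R v') = map length (irreducible_decomp v')"
      "F_R_star (F_R v') = v'"
    using "2.IH"(1)[OF "2.prems" uv(1)[symmetric] I(1)[symmetric] u(1)]
      "2.IH"(2)[OF "2.prems" uv(1)[symmetric] I(1)[symmetric] v'(1)] by auto
  have wt: "sum_list (map weight (F_R u)) = length u" "sum_list (map weight (F_R v')) = length v'"
    using IHu(2) IHv(2) irreducible_decomp(2)[OF u(1)] irreducible_decomp(2)[OF v'(1)]
    by (metis length_odot_list)+
  have cond: "irreducible_decomp v' = [] \<or> irreducible_decomp v' \<noteq> [] \<and>
      Min I \<le> length (hd (irreducible_decomp v')) \<and>
      card I + length v' < length (last (irreducible_decomp v')) + Max I"
    using irreducible_red_fact_iff[OF u(1) I(2)] "2.prems" uv(2) w by blast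
  have "red_packed_tree (Node I (F_R u) (F_R v'))"
  proof (cases "F_R v' = []")
    case True
    then have "v' = []" using wt(2) by simp
    then have "I = {1..card I}" using v' by (intro card_subset_eq) auto
    then show ?thesis using True d(6) v' IHu(1) by (auto simp: red_packed_forest_def)
  next
    case False
    then have ne: "irreducible_decomp v' \<noteq> []" using IHv(2) by (metis map_is_Nil_conv)
    have "weight (hd (F_R v')) = length (hd (irreducible_decomp v'))"
      "weight (last (F_R v')) = length (last (irreducible_decomp v'))"
      using False ne IHv(2) by (metis hd_map, metis last_map)
    \<comment> \<open>\<open>Max I \<le> length v' + card I\<close> is the lower bound 1 in the
      integer condition; the remaining two bounds come from \<open>cond\<close>.\<close>
    moreover have "Min I \<in> I" "Max I \<in> I" using v' d(6) by simp_all
    then have "1 \<le> Min I" "Max I \<le> length v' + card I"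
      using v'(4) by (meson subsetD atLeastAtMost_iff)+
    ultimately have "1 \<le> Min I \<and> Min I \<le> weight (hd (F_R v')) \<and>
        1 \<le> int (card I) + int (forest_weight (F_R v')) + 1 - int (Max I) \<and>
        int (card I) + int (forest_weight (F_R v')) + 1 - int (Max I) \<le> int (weight (last (F_R v')))"
      using ne cond wt(2) unfolding forest_weight_def by linarith
    moreover have "\<forall>i\<in>I. 1 \<le> i" using v'(4) by auto
    ultimately show ?thesis
      using False d(6) v'(3) IHu(1) IHv(1)
      unfolding red_packed_tree.simps red_packed_forest_def by blast
  qed
  moreover have "weight (T_R w) = length w" using wt e is_tri_R_fact_length[OF f] d(3) by simp
  moreover have "T_R_star (T_R w) = w" using e IHu(3) IHv(3) w v'(2) by (simp add: T_R_star.simps)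
  ultimately show ?case unfolding e by blast
qed

text \<open>Packedness and irreducibility are carried along because \<open>F_R\<close> and
  \<open>T_R\<close> are unspecified elsewhere. The equality of length lists translates the weights
  of the outer trees into the block lengths of \<open>irreducible_red_fact_iff\<close>.\<close>

lemma F_R_star_T_R_star_correct:
  "red_packed_forest f \<Longrightarrow> packed (F_R_star f) \<and>
    map length (irreducible_decomp (F_R_star f)) = map weight f \<and> F_R (F_R_star f) = f"
  "red_packed_tree t \<Longrightarrow> irreducible_word (T_R_star t) \<and> length (T_R_star t) = weight t \<and>
    T_R (T_R_star t) = t"
proof (induction f and t rule: F_R_star_T_R_star.induct)
  case (1 ts)
  then have IH: "irreducible_word (T_R_star t) \<and> length (T_R_star t) = weight t \<and>
    T_R (T_R_star t) = t" if "t \<in> set ts" for t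
    using that by (auto simp: red_packed_forest_def)
  have e: "F_R_star ts = odot_list (map T_R_star ts)" by (simp add: F_R_star.simps)
  have d: "irreducible_decomp (F_R_star ts) = map T_R_star ts"
    unfolding e using IH by (intro irreducible_decomp_eqI) auto
  have p: "packed (F_R_star ts)" unfolding e using IH by (intro packed_odot_list) auto
  have "F_R (F_R_star ts) = map T_R (map T_R_star ts)"
    by (subst F_R.simps) (simp only: p d if_True)
  also have "\<dots> = ts" using IH by (simp add: map_idI)
  finally show ?case using p d IH by simp
next
  case (2 I fl fr)
  let ?u = "F_R_star fl" and ?v' = "F_R_star fr"
  have rp: "finite I" "I \<noteq> {}" "\<forall>i\<in>I. 1 \<le> i" "red_packed_forest fl" "red_packed_forest fr"
    using "2.prems" by (simp_all add: red_packed_forest_def)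
  have cond: "fr = [] \<and> I = {1..card I} \<or> fr \<noteq> [] \<and> Min I \<le> weight (hd fr) \<and>
      Max I \<le> card I + forest_weight fr \<and>
      card I + forest_weight fr < weight (last fr) + Max I"
    using "2.prems" unfolding red_packed_tree.simps by linarith
  have IHu: "packed ?u" "map length (irreducible_decomp ?u) = map weight fl" "F_R ?u = fl"
    and IHv: "packed ?v'" "map length (irreducible_decomp ?v') = map weight fr" "F_R ?v' = fr"
    using "2.IH" rp by auto
  have len: "length ?u = forest_weight fl" "length ?v' = forest_weight fr"
    using IHu(2) IHv(2) irreducible_decomp(2)[OF IHu(1)] irreducible_decomp(2)[OF IHv(1)]
    unfolding forest_weight_def by (metis length_odot_list)+
  \<comment> \<open>For nonempty \<open>fr\<close>, the lower bound 1 in the red-packed condition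
    keeps \<open>Max I\<close> within the word, so that \<open>I\<close> is an admissible set of
    positions.\<close>
  have "I \<subseteq> {1..length ?v' + card I}"
  proof (cases "fr = []")
    case True
    then have "I = {1..card I}" using cond by simp
    moreover have "{1..card I} \<subseteq> {1..length ?v' + card I}" by simp
    ultimately show ?thesis by metis
  next
    case False
    then have "Max I \<le> length ?v' + card I" using cond len by simp
    then show ?thesis using rp(1,3) by (auto intro: order_trans[OF Max_ge])
  qed
  then have v: "is_phi_decomp (phi I ?v') I ?v'" using IHv(1) rp by (simp add: is_phi_decomp_def)
  define w where "w = ?u \<triangleleft>\<^sub>R phi I ?v'"
  have t: "T_R_star (Node I fl fr) = w" by (simp add: T_R_star.simps w_def)
  have iff: "irreducible_decomp ?v' = [] \<longleftrightarrow> fr = []" using IHv(2) by (metis map_is_Nil_conv)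
  moreover have "length (hd (irreducible_decomp ?v')) = weight (hd fr)"
    "length (last (irreducible_decomp ?v')) = weight (last fr)" if "fr \<noteq> []"
    using that iff IHv(2) by (metis hd_map, metis last_map)
  ultimately have irr: "irreducible_word w" and red: "is_red_fact w ?u (phi I ?v')"
    using irreducible_red_fact_iff[OF IHu(1) v] cond len unfolding w_def by auto
  have "T_R w = Node I fl fr"
    using irr red_fact_eqI[OF irr red] phi_decomp_eqI[OF v] IHu(3) IHv(3) by (simp add: T_R.simps)
  moreover have "length w = weight (Node I fl fr)"
    using is_tri_R_fact_length[of w ?u "phi I ?v'"] red len by (simp add: is_red_fact_def forest_weight_def)
  ultimately show ?case using irr t by simp
qed

lemma forest_weight_F_R: "packed w \<Longrightarrow> forest_weight (F_R w) = length w"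
  using F_R_T_R_correct(1)[of w] irreducible_decomp(2)[of w] unfolding forest_weight_def
  by (metis length_odot_list)

lemma length_F_R_star: "red_packed_forest f \<Longrightarrow> length (F_R_star f) = forest_weight f"
  using F_R_star_T_R_star_correct(1)[of f] forest_weight_F_R[of "F_R_star f"] by simp

theorem mainTheorem5:
  fixes n :: nat
  shows "bij_betw F_R (PW n) {f. red_packed_forest f \<and> forest_weight f = n} \<and>
         bij_betw T_R {w \<in> PW n. irreducible_word w} {t. red_packed_tree t \<and> weight t = n} \<and>
         (\<forall>w\<in>PW n. F_R_star (F_R w) = w) \<and>
         (\<forall>f. red_packed_forest f \<and> forest_weight f = n \<longrightarrow> F_R (F_R_star f) = f) \<and>
         (\<forall>w\<in>PW n. irreducible_word w \<longrightarrow> T_R_star (T_R w) = w) \<and>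
         (\<forall>t. red_packed_tree t \<and> weight t = n \<longrightarrow> T_R (T_R_star t) = t)"
proof (intro conjI)
  show "bij_betw F_R (PW n) {f. red_packed_forest f \<and> forest_weight f = n}"
    by (rule bij_betw_byWitness[where f' = F_R_star])
      (auto simp: PW_def F_R_T_R_correct F_R_star_T_R_star_correct forest_weight_F_R length_F_R_star)
  \<comment> \<open>Membership of \<open>T_R_star t\<close> in \<open>PW n\<close> needs its
    packedness, which is read off from its irreducibility.\<close>
  show "bij_betw T_R {w \<in> PW n. irreducible_word w} {t. red_packed_tree t \<and> weight t = n}"
    by (rule bij_betw_byWitness[where f' = T_R_star])
      (auto simp: PW_def F_R_T_R_correct F_R_star_T_R_star_correct irreducible_word_def[of "T_R_star _"]
        dest: F_R_star_T_R_star_correct(2))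
qed (auto simp: PW_def F_R_T_R_correct F_R_star_T_R_star_correct)

end
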